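(* Let $r\ge 3$. If $2^r-k=2\ell+1$, then $v_2(c(2^r,k))\ge r$ unless $\ell=0$ or $\ell=2^{r-2}$, and in either of these two cases $v_2(c(2^r,k))=r-1$. If on the other hand $2^r-k=2\ell$, then $$v_2(c(2^r,k))=r-2-v_2(\ell).$$
   Context: Here $r$, $k$ and $\ell$ are integers. For a nonzero integer $m$, $v_2(m)$ denotes the exponent of the highest power of $2$ dividing $m$, and $v_2(0)=+\infty$. The numbers $c(n,k)$ are the signless Stirling numbers of the first kind, defined by the polynomial identity $\prod_{j=0}^{n-1}(1+jt)=\sum_{k=0}^{n}c(n,k)\,t^{n-k}$ in $\mathbb{Z}[t]$, with $c(n,k)=0$ for $k<0$ or $k>n$.
   Formalization: The formula for 2^r-k=2ℓ is stated only for 1 ≤ ℓ ≤ 2^{r-2}; it fails for every other ℓ, e.g. ℓ=0 (c=1), or r=3, ℓ=3, where v_2(c(8,2))=2 but the formula gives 1. *)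

theory Defs
  imports
    "HOL-Combinatorics.Stirling"
    "HOL-Computational_Algebra.Computational_Algebra"
    "HOL-Library.Extended_Real"
begin

text \<open>The values are extended reals, so that \<open>v2 0 = \<infinity>\<close> and subtraction of valuations does
  not truncate.\<close>

definition v2 :: "int \<Rightarrow> ereal" where
  "v2 m = (if m = 0 then \<infinity> else ereal (real (multiplicity 2 m)))"

text \<open>\<open>stirling n k\<close> is the library's signless Stirling number of the first kind, given by the
  usual recurrence; \<open>c\<close> extends it by \<open>0\<close> to negative \<open>k\<close>. The lemmas \<open>c_generating_polynomial\<close>
  and \<open>c_outside\<close> show that \<open>c\<close> is the family defined by
  \<open>\<Prod>j<n. (1 + j t) = \<Sum>k\<le>n. c(n,k) t^(n-k)\<close> and by \<open>c(n,k) = 0\<close> for \<open>k < 0\<close> or \<open>k > n\<close>.\<close>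

definition c :: "nat \<Rightarrow> int \<Rightarrow> int" where
  "c n k = (if k < 0 then 0 else int (stirling n (nat k)))"

lemma c_outside: "k < 0 \<or> k > int n \<Longrightarrow> c n k = 0"
  by (auto simp: c_def)

lemma c_generating_polynomial:
  "(\<Prod>j<n. [:1, int j:]) = (\<Sum>k\<le>n. monom (c n (int k)) (n - k))"
proof (induction n)
  case 0
  show ?case by (simp add: c_def)
next
  case (Suc n)
  have "(\<Sum>k\<le>Suc n. monom (c (Suc n) (int k)) (Suc n - k))
      = (\<Sum>k\<le>n. monom (int (stirling (Suc n) (Suc k))) (n - k))"
    by (subst sum.atMost_Suc_shift) (simp add: c_def nat_add_distrib)
  also have "\<dots> = (\<Sum>k\<le>n. monom (int n * int (stirling n (Suc k))) (n - k))
      + (\<Sum>k\<le>n. monom (int (stirling n k)) (n - k))"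
    by (simp add: add_monom [symmetric] sum.distrib)
  also have "(\<Sum>k\<le>n. monom (int n * int (stirling n (Suc k))) (n - k))
      = (\<Sum>k\<le>n. monom (int n * int (stirling n k)) (Suc n - k))"
  proof -
    have "(\<Sum>k\<le>Suc n. monom (int n * int (stirling n k)) (Suc n - k))
        = monom (int n * int (stirling n 0)) (Suc n)
          + (\<Sum>k\<le>n. monom (int n * int (stirling n (Suc k))) (n - k))"
      by (subst sum.atMost_Suc_shift) simp
    moreover have "int n * int (stirling n 0) = 0"
      by (cases n) auto
    ultimately show ?thesis by simp
  qed
  also have "\<dots> = [:0, int n:] * (\<Sum>k\<le>n. monom (int (stirling n k)) (n - k))"
    unfolding sum_distrib_left
    by (intro sum.cong refl) (simp add: Suc_diff_le smult_monom monom_Suc)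
  finally have "(\<Sum>k\<le>Suc n. monom (c (Suc n) (int k)) (Suc n - k))
      = ([:0, int n:] + 1) * (\<Sum>k\<le>n. monom (int (stirling n k)) (n - k))"
    by (simp add: algebra_simps)
  also have "[:0, int n:] + 1 = [:1, int n:]"
    by (simp add: one_pCons)
  finally show ?case
    using Suc.IH by (simp add: c_def mult.commute)
qed

end

theory Submission
  imports Defs
begin

text \<open>
  Modulo \<open>N = 2n\<close> the factors \<open>1 + j t\<close> and \<open>1 + (N - j) t\<close> multiply to \<open>1 - j\<^sup>2 t\<^sup>2\<close>, and only
  \<open>j = 0\<close> and \<open>j = n\<close> are left without a partner. Hence
  \<open>\<Prod>j<2n. (1 + j t) \<equiv> (1 + n t) F\<^sub>n(t\<^sup>2) (mod 2n)\<close> with \<open>F\<^sub>n(u) = \<Prod>0<j<n. (1 - j\<^sup>2 u)\<close>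
  (lemma \<open>rising_poly_pcong\<close>). For \<open>n = 2^(r-1)\<close> this gives, modulo \<open>2^r\<close>,
  \<open>c(2^r, 2^r - 2l) \<equiv> f\<^sub>l\<close> and \<open>c(2^r, 2^r - 2l - 1) \<equiv> 2^(r-1) f\<^sub>l\<close>, where \<open>f\<^sub>l\<close> is the coefficient
  of \<open>u^l\<close> in \<open>F\<^sub>n\<close>.

  The same pairing, now for \<open>j\<^sup>2\<close> and \<open>(2n - j)\<^sup>2\<close>, shows \<open>F\<^sub>2\<^sub>n \<equiv> F\<^sub>n\<^sup>2 (mod 2n)\<close> for even \<open>n\<close>.
  Squaring raises the exponent in a congruence modulo a power of 2 by one, so starting from
  \<open>F\<^sub>2 = 1 - u\<close> one gets \<open>F\<^sub>n \<equiv> (1 - u)^(2^s) (mod 2^(s+1))\<close> for \<open>n = 2^(s+1)\<close>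
  (lemma \<open>square_poly_pcong\<close>). Thus \<open>f\<^sub>l\<close> is, up to sign, the binomial coefficient
  \<open>2^s choose l\<close> modulo \<open>2^(s+1)\<close>. For \<open>1 \<le> l \<le> 2^s\<close> its 2-adic valuation is
  \<open>s - v\<^sub>2(l)\<close>, which is smaller than \<open>s + 1\<close> and hence is the valuation of \<open>f\<^sub>l\<close>. With \<open>s = r - 2\<close> this is
  the claim for even differences. In the odd case only the parity of \<open>f\<^sub>l\<close> matters, and
  \<open>2^s choose l\<close> is odd exactly for \<open>l = 0\<close> and \<open>l = 2^s\<close>.
\<close>

section \<open>Binomial coefficients of a prime power\<close>

text \<open>Compare the powers of \<open>p\<close> on both sides of \<open>j (q choose j) = q (q - 1 choose j - 1)\<close>, \<open>q = p^s\<close>: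
  if \<open>p\<close> did not divide \<open>q choose j\<close>, then \<open>q\<close> would divide \<open>j < q\<close>.\<close>

lemma prime_dvd_prime_power_choose:
  fixes p :: nat
  assumes "prime p" "0 < j" "j < p ^ s"
  shows "p dvd (p ^ s choose j)"
proof (rule ccontr)
  assume "\<not> p dvd (p ^ s choose j)"
  then have "coprime (p ^ s) (p ^ s choose j)"
    using assms(1) by (simp add: prime_imp_coprime)
  moreover have "p ^ s dvd j * (p ^ s choose j)"
    using times_binomial_minus1_eq[OF assms(2), of "p ^ s"] by simp
  ultimately have "p ^ s dvd j"
    by (simp add: coprime_dvd_mult_left_iff)
  with assms show False
    by (auto dest: dvd_imp_le)
qed

text \<open>By Pascal's rule and the previous lemma the entries of row \<open>p^s - 1\<close> are alternately \<open>1\<close> and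
  \<open>-1\<close> modulo \<open>p\<close>.\<close>

lemma not_prime_dvd_prime_power_minus_1_choose:
  fixes p :: nat
  assumes "prime p" "j < p ^ s"
  shows "\<not> p dvd (p ^ s - 1 choose j)"
  using assms(2)
proof (induction j)
  case 0
  show ?case using assms(1) by (auto dest: prime_gt_1_nat)
next
  case (Suc j)
  obtain q where q: "p ^ s = Suc q"
    using Suc.prems by (cases "p ^ s") auto
  have "p dvd (p ^ s choose Suc j)"
    using prime_dvd_prime_power_choose[OF assms(1) _ Suc.prems] by simp
  then have "p dvd (q choose j) + (q choose Suc j)"
    by (simp add: q)
  moreover have "\<not> p dvd (q choose j)"
    using Suc by (simp add: q)
  ultimately show ?case
    by (simp add: q) (metis dvd_add_left_iff)
qed

lemma multiplicity_prime_power_choose: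
  fixes p :: nat
  assumes "prime p" "0 < j" "j \<le> p ^ s"
  shows "multiplicity p (p ^ s choose j) + multiplicity p j = s"
proof -
  let ?b = "p ^ s - 1 choose (j - 1)"
  have nd: "\<not> p dvd ?b"
    using not_prime_dvd_prime_power_minus_1_choose[OF assms(1), of "j - 1" s] assms by simp
  have "multiplicity p (j * (p ^ s choose j)) = multiplicity p (p ^ s * ?b)"
    using times_binomial_minus1_eq[OF assms(2), of "p ^ s"] by simp
  moreover have "?b \<noteq> 0" using nd by (metis dvd_0_right)
  ultimately show ?thesis
    using assms nd
    by (simp add: prime_elem_multiplicity_mult_distrib not_dvd_imp_multiplicity_0 
        multiplicity_same_power prime_gt_0_nat)
qed

section \<open>Congruence of integer polynomials\<close>

definition pcong :: "int \<Rightarrow> int poly \<Rightarrow> int poly \<Rightarrow> bool" where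
  "pcong m p q \<longleftrightarrow> [:m:] dvd p - q"

lemma pcong_coeff: "pcong m p q \<Longrightarrow> m dvd coeff p i - coeff q i"
  by (simp add: pcong_def const_poly_dvd_iff)

lemma pcong_refl [simp]: "pcong m p p"
  by (simp add: pcong_def)

lemma pcong_trans: "pcong m p q \<Longrightarrow> pcong m q w \<Longrightarrow> pcong m p w"
  unfolding pcong_def using dvd_add[of "[:m:]" "p - q" "q - w"] by simp

lemma pcong_mult:
  assumes "pcong m p q" "pcong m p' q'"
  shows "pcong m (p * p') (q * q')"
proof -
  have "p * p' - q * q' = (p - q) * p' + q * (p' - q')"
    by (simp add: algebra_simps)
  then show ?thesis
    using assms by (simp add: pcong_def)
qed

lemma pcong_prod: "(\<And>i. i \<in> A \<Longrightarrow> pcong m (f i) (g i)) \<Longrightarrow> pcong m (prod f A) (prod g A)"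
  by (induction A rule: infinite_finite_induct) (auto intro: pcong_mult)

lemma pcong_linear: "m dvd a - b \<Longrightarrow> pcong m [:1, a:] [:1, b:]"
  by (auto simp: pcong_def const_poly_dvd_iff coeff_pCons split: nat.split)

text \<open>\<open>p\<^sup>2 - q\<^sup>2 = (p - q) (p - q + 2q)\<close>; the first factor is a multiple of
  \<open>m\<close>, and the second is even because \<open>m\<close> is.\<close>

lemma pcong_square:
  assumes "pcong m p q" "even m"
  shows "pcong (2 * m) (p\<^sup>2) (q\<^sup>2)"
proof -
  obtain w where w: "p - q = [:m:] * w"
    using assms(1) by (auto simp: pcong_def)
  obtain m' where m': "m = 2 * m'"
    using assms(2) by blast
  have "p\<^sup>2 - q\<^sup>2 = (p - q) * (p - q + 2 * q)"
    by (simp add: power2_eq_square algebra_simps)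
  also have "\<dots> = [:m:] * [:2:] * (w * ([:m':] * w + q))"
    by (simp add: w m' algebra_simps smult_add_right numeral_poly)
  also have "[:m:] * [:2:] = [:2 * m:]"
    by simp
  finally show ?thesis
    unfolding pcong_def by (metis dvd_triv_left)
qed

section \<open>Pairing the factors\<close>

text \<open>Splitting off \<open>j = n\<close> and reflecting the upper half by \<open>j \<mapsto> 2n - j\<close>.\<close>

lemma prod_reflect_upper_half:
  fixes f :: "nat \<Rightarrow> 'a::comm_monoid_mult"
  assumes "0 < n"
  shows "(\<Prod>j\<in>{1..<2 * n}. f j) = f n * (\<Prod>j\<in>{1..<n}. f j * f (2 * n - j))"
proof -
  have "{1..<2 * n} = insert n ({1..<n} \<union> {n<..<2 * n})"
    using assms by auto
  then have "(\<Prod>j\<in>{1..<2 * n}. f j) = f n * (prod f {1..<n} * prod f {n<..<2 * n})"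
    by (simp, subst prod.union_disjoint) auto
  also have "prod f {n<..<2 * n} = (\<Prod>j\<in>{1..<n}. f (2 * n - j))"
    by (rule prod.reindex_bij_witness[of _ "\<lambda>j. 2 * n - j" "\<lambda>j. 2 * n - j"]) auto
  finally show ?thesis
    by (simp add: prod.distrib)
qed

text \<open>The polynomial \<open>F\<^sub>n\<close> in the variable \<open>u = t\<^sup>2\<close>.\<close>

definition square_poly :: "nat \<Rightarrow> int poly" where
  "square_poly n = (\<Prod>j\<in>{1..<n}. [:1, - (int j)\<^sup>2:])"

text \<open>Pairing \<open>j\<close> with \<open>2n - j \<equiv> -j\<close> leaves over the factor of \<open>j = n\<close>. This factor contributes
  all odd powers of \<open>t\<close>, which is why the odd coefficients are those of \<open>F\<^sub>n\<close> times \<open>n\<close>.\<close>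

lemma rising_poly_pcong:
  assumes "0 < n"
  shows "pcong (2 * int n) (\<Prod>j<2 * n. [:1, int j:])
           ([:1, int n:] * pcompose (square_poly n) [:0, 0, 1:])"
proof -
  have "{..<2 * n} = insert 0 {1..<2 * n}"
    using assms by auto
  then have "(\<Prod>j<2 * n. [:1, int j:]) = (\<Prod>j\<in>{1..<2 * n}. [:1, int j:])"
    by (simp add: pCons_one)
  also have "\<dots> = [:1, int n:] * (\<Prod>j\<in>{1..<n}. [:1, int j:] * [:1, int (2 * n - j):])"
    by (rule prod_reflect_upper_half[OF assms])
  finally have split: "(\<Prod>j<2 * n. [:1, int j:])
      = [:1, int n:] * (\<Prod>j\<in>{1..<n}. [:1, int j:] * [:1, int (2 * n - j):])" .
  have "pcong (2 * int n) ([:1, int j:] * [:1, int (2 * n - j):])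
          (pcompose [:1, - (int j)\<^sup>2:] [:0, 0, 1:])" if "j \<in> {1..<n}" for j
  proof -
    have "pcong (2 * int n) ([:1, int j:] * [:1, int (2 * n - j):]) ([:1, int j:] * [:1, - int j:])"
      using that by (intro pcong_mult pcong_linear pcong_refl) (simp add: of_nat_diff)
    also have "[:1, int j:] * [:1, - int j:] = pcompose [:1, - (int j)\<^sup>2:] [:0, 0, 1:]"
      by (simp add: pcompose_pCons power2_eq_square)
    finally show ?thesis .
  qed
  then show ?thesis
    unfolding split square_poly_def pcompose_prod
    by (intro pcong_mult pcong_prod pcong_refl)
qed

text \<open>Here \<open>(2n - j)\<^sup>2 \<equiv> j\<^sup>2\<close>, so every pair contributes a square, and the middle factor
  \<open>1 - n\<^sup>2 u\<close> disappears because \<open>2n\<close> divides \<open>n\<^sup>2\<close> for even \<open>n\<close>.\<close>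

lemma square_poly_double:
  assumes "0 < n" "even n"
  shows "pcong (2 * int n) (square_poly (2 * n)) ((square_poly n)\<^sup>2)"
proof -
  have split: "square_poly (2 * n) = [:1, - (int n)\<^sup>2:] *
      (\<Prod>j\<in>{1..<n}. [:1, - (int j)\<^sup>2:] * [:1, - (int (2 * n - j))\<^sup>2:])"
    unfolding square_poly_def by (rule prod_reflect_upper_half[OF assms(1)])
  \<comment> \<open>The factor \<open>[:1, 0:] = 1\<close> is the counterpart of the middle factor.\<close>
  have sq: "(square_poly n)\<^sup>2 = [:1, 0:] * (\<Prod>j\<in>{1..<n}. [:1, - (int j)\<^sup>2:] * [:1, - (int j)\<^sup>2:])"
    unfolding square_poly_def prod.distrib by (simp add: power2_eq_square pCons_one)
  have "2 * int n dvd - (int n)\<^sup>2 - 0"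
    using assms(2) by (auto simp: power2_eq_square elim!: evenE)
  moreover have "2 * int n dvd - (int (2 * n - j))\<^sup>2 - (- (int j)\<^sup>2)" if "j \<in> {1..<n}" for j
  proof -
    have "- (int (2 * n - j))\<^sup>2 - (- (int j)\<^sup>2) = 2 * int n * (2 * int j - 2 * int n)"
      using that by (simp add: of_nat_diff power2_eq_square algebra_simps)
    then show ?thesis by simp
  qed
  ultimately show ?thesis
    unfolding split sq by (intro pcong_mult pcong_prod pcong_linear pcong_refl) auto
qed

lemma square_poly_pcong:
  "pcong (2 ^ Suc s) (square_poly (2 ^ Suc s)) ([:1, -1:] ^ (2 ^ s))"
proof (induction s)
  case 0
  have "{1..<2::nat} = {1}" by auto
  then show ?case by (simp add: square_poly_def)
next
  case (Suc s)
  have "pcong (2 ^ Suc (Suc s)) (square_poly (2 ^ Suc (Suc s))) ((square_poly (2 ^ Suc s))\<^sup>2)"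
    using square_poly_double[of "2 ^ Suc s"] by simp
  moreover have "pcong (2 ^ Suc (Suc s)) ((square_poly (2 ^ Suc s))\<^sup>2) (([:1, -1:] ^ (2 ^ s))\<^sup>2)"
    using pcong_square[OF Suc.IH] by simp
  ultimately have "pcong (2 ^ Suc (Suc s)) (square_poly (2 ^ Suc (Suc s))) (([:1, -1:] ^ (2 ^ s))\<^sup>2)"
    by (rule pcong_trans)
  moreover have "([:1, -1:] ^ (2 ^ s))\<^sup>2 = ([:1, -1:] ^ (2 ^ Suc s) :: int poly)"
    by (simp only: power_mult [symmetric] power_Suc mult.commute)
  ultimately show ?case by (simp only:)
qed

section \<open>Passing to coefficients\<close>

lemma coeff_one_minus_x_power:
  "coeff ([:1, -1:] ^ n) i = (-1) ^ i * int (n choose i)"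
proof (induction n arbitrary: i)
  case 0
  show ?case by (cases i) (simp_all)
next
  case (Suc n)
  show ?case
    by (cases i) (simp_all add: Suc.IH algebra_simps)
qed

lemma square_poly_coeff:
  "2 ^ Suc s dvd coeff (square_poly (2 ^ Suc s)) i - (-1) ^ i * int (2 ^ s choose i)"
  using pcong_coeff[OF square_poly_pcong, of s i] by (simp only: coeff_one_minus_x_power)

lemma coeff_pcompose_square:
  fixes p :: "'a::comm_semiring_1 poly"
  shows "coeff (pcompose p [:0, 0, 1:]) (2 * i) = coeff p i"
    and "coeff (pcompose p [:0, 0, 1:]) (Suc (2 * i)) = 0"
proof (induction p arbitrary: i)
  case 0
  { case 1 show ?case by simp }
  { case 2 show ?case by simp }
next
  case (pCons a p)
  { case 1 show ?case by (cases i) (simp_all add: pcompose_pCons pCons) }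
  { case 2 show ?case by (cases i) (simp_all add: pcompose_pCons pCons) }
qed

lemma c_eq_coeff: "c n (int n - int m) = coeff (\<Prod>j<n. [:1, int j:]) m"
proof (cases "m \<le> n")
  case True
  have "coeff (\<Prod>j<n. [:1, int j:]) m = (\<Sum>k\<le>n. if k = n - m then c n (int k) else 0)"
    unfolding c_generating_polynomial coeff_sum using True
    by (intro sum.cong) auto
  also have "\<dots> = c n (int n - int m)"
    using True by (simp add: of_nat_diff)
  finally show ?thesis by simp
next
  case False
  then show ?thesis
    unfolding c_generating_polynomial by (auto simp: coeff_sum c_outside intro!: sum.neutral)
qed

lemma c_even_cong:
  assumes "0 < n"
  shows "2 * int n dvd c (2 * n) (int (2 * n) - int (2 * i)) - coeff (square_poly n) i"
proof -
  have "coeff ([:1, int n:] * pcompose (square_poly n) [:0, 0, 1:]) (2 * i) = coeff (square_poly n) i"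
  proof (cases i)
    case 0
    then show ?thesis using coeff_pcompose_square(1)[of "square_poly n" 0] by simp
  next
    case (Suc h)
    then show ?thesis
      using coeff_pcompose_square(1)[of "square_poly n" i] coeff_pcompose_square(2)[of "square_poly n" h]
      by simp
  qed
  then show ?thesis
    using pcong_coeff[OF rising_poly_pcong[OF assms], of "2 * i"] by (simp only: c_eq_coeff)
qed

lemma c_odd_cong:
  assumes "0 < n"
  shows "2 * int n dvd c (2 * n) (int (2 * n) - int (Suc (2 * i))) - int n * coeff (square_poly n) i"
proof -
  have "coeff ([:1, int n:] * pcompose (square_poly n) [:0, 0, 1:]) (Suc (2 * i))
      = int n * coeff (square_poly n) i"
    using coeff_pcompose_square[of "square_poly n" i] by simp
  then show ?thesis
    using pcong_coeff[OF rising_poly_pcong[OF assms], of "Suc (2 * i)"] by (simp only: c_eq_coeff)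
qed

section \<open>Valuations\<close>

lemma dvd_iff_of_dvd_diff: "m dvd x - y \<Longrightarrow> m dvd x \<longleftrightarrow> m dvd y" for m x y :: int
  using dvd_add_right_iff[of m "x - y" y] by simp

lemma v2_ge: "2 ^ k dvd m \<Longrightarrow> v2 m \<ge> ereal (real k)"
  by (auto simp: v2_def intro!: multiplicity_geI)

lemma v2_eq:
  assumes "2 ^ k dvd m" "\<not> 2 ^ Suc k dvd m"
  shows "v2 m = ereal (real k)"
proof -
  have "m \<noteq> 0" using assms(2) by auto
  moreover have "multiplicity 2 m = k"
    using assms by (intro multiplicity_eqI) auto
  ultimately show ?thesis by (simp add: v2_def)
qed

lemma multiplicity_int: "multiplicity (int p) (int n) = multiplicity p n"
  by (simp add: multiplicity_def flip: of_nat_power)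

lemma multiplicity_2_int: "multiplicity 2 (int n) = multiplicity 2 n"
  using multiplicity_int[of 2 n] by simp

lemma odd_choose_power_2_iff: "odd (2 ^ s choose i) \<longleftrightarrow> i = 0 \<or> i = 2 ^ s"
proof (cases "i = 0 \<or> i \<ge> 2 ^ s")
  case True
  then show ?thesis by (cases "i = 0"; cases "i = 2 ^ s") (auto simp: binomial_eq_0)
next
  case False
  then show ?thesis
    using prime_dvd_prime_power_choose[of 2 i s] by simp
qed

lemma odd_square_poly_coeff_iff:
  "odd (coeff (square_poly (2 ^ Suc s)) i) \<longleftrightarrow> i = 0 \<or> i = 2 ^ s"
proof -
  have "even (coeff (square_poly (2 ^ Suc s)) i - (-1) ^ i * int (2 ^ s choose i))"
    using square_poly_coeff[of s i] by (rule dvd_trans[rotated]) simp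
  then show ?thesis
    using odd_choose_power_2_iff[of s i] by auto
qed

text \<open>A number congruent to \<open>\<plusminus> (2^s choose i)\<close> modulo \<open>2^(s+1)\<close> inherits its valuation, since that
  valuation is at most \<open>s\<close>.\<close>

lemma v2_square_poly_coeff_cong:
  assumes "0 < i" "i \<le> 2 ^ s" "2 ^ Suc s dvd x - coeff (square_poly (2 ^ Suc s)) i"
  shows "v2 x = ereal (real s) - v2 (int i)"
proof -
  define b where "b = (-1) ^ i * int (2 ^ s choose i)"
  define a where "a = multiplicity 2 (2 ^ s choose i)"
  have a: "a + multiplicity 2 i = s"
    unfolding a_def using multiplicity_prime_power_choose[of 2 i s] assms by simp
  have "int (2 ^ s choose i) \<noteq> 0"
    using assms by simp
  then have "2 ^ k dvd int (2 ^ s choose i) \<longleftrightarrow> k \<le> a" for k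
    unfolding a_def multiplicity_2_int [symmetric]
    by (intro power_dvd_iff_le_multiplicity) auto
  then have dvd_b: "2 ^ k dvd b \<longleftrightarrow> k \<le> a" for k
    unfolding b_def by (simp add: dvd_mult_unit_iff' is_unit_power_iff)
  have "2 ^ Suc s dvd x - b"
    using dvd_add[OF assms(3) square_poly_coeff[of s i]] by (simp add: b_def)
  then have *: "2 ^ k dvd x \<longleftrightarrow> 2 ^ k dvd b" if "k \<le> Suc s" for k
    using that by (intro dvd_iff_of_dvd_diff) (meson dvd_trans le_imp_power_dvd)
  have "v2 x = ereal (real a)"
    using a by (intro v2_eq) (simp_all add: * dvd_b del: power_Suc)
  then show ?thesis
    using a assms(1) by (auto simp: v2_def multiplicity_2_int)
qed

theorem corollary1p3:
  fixes r :: nat and k l :: int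
  assumes "r \<ge> 3"
  shows "(2 ^ r - k = 2 * l + 1 \<longrightarrow>
            (\<not> (l = 0 \<or> l = 2 ^ (r - 2)) \<longrightarrow> v2 (c (2 ^ r) k) \<ge> ereal (real r)) \<and>
            (l = 0 \<or> l = 2 ^ (r - 2) \<longrightarrow> v2 (c (2 ^ r) k) = ereal (real r - 1))) \<and>
         (2 ^ r - k = 2 * l \<and> 1 \<le> l \<and> l \<le> 2 ^ (r - 2) \<longrightarrow>
            v2 (c (2 ^ r) k) = ereal (real r - 2) - v2 l)"
proof -
  obtain s where r: "r = Suc (Suc s)"
    using assms that[of "r - 2"] by simp
  let ?n = "2 ^ Suc s :: nat"
  let ?f = "\<lambda>i. coeff (square_poly ?n) i"
  have odd_case: "(\<not> (l = 0 \<or> l = 2 ^ s) \<longrightarrow> v2 (c (2 ^ r) k) \<ge> ereal (real r)) \<and>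
      (l = 0 \<or> l = 2 ^ s \<longrightarrow> v2 (c (2 ^ r) k) = ereal (real (Suc s)))"
    if kl: "2 ^ r - k = 2 * l + 1"
  proof (cases "l < 0")
    case True
    then have "k > int (2 ^ r)"
      using kl by simp
    then have "c (2 ^ r) k = 0"
      by (intro c_outside) simp
    moreover have "l \<noteq> 2 ^ s"
      using True by (smt (verit) zero_less_power)
    ultimately show ?thesis
      using True by (simp add: v2_def)
  next
    case False
    then obtain i where l: "l = int i"
      by (metis nonneg_int_cases not_less)
    have k: "k = int (2 * ?n) - int (Suc (2 * i))"
      using kl by (simp add: r l)
    have d: "2 ^ r dvd c (2 ^ r) k - 2 ^ Suc s * ?f i"
      using c_odd_cong[of ?n i] by (simp add: k r)
    have iff: "2 ^ r dvd c (2 ^ r) k \<longleftrightarrow> even (?f i)"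
    proof -
      have "2 ^ r dvd c (2 ^ r) k \<longleftrightarrow> 2 ^ r dvd 2 ^ Suc s * ?f i"
        using d by (rule dvd_iff_of_dvd_diff)
      also have "\<dots> \<longleftrightarrow> even (?f i)"
        by (simp only: r power_Suc2[of _ "Suc s"] dvd_mult_cancel_left) simp
      finally show ?thesis .
    qed
    have "2 ^ Suc s dvd c (2 ^ r) k - 2 ^ Suc s * ?f i"
      using d by (rule dvd_trans[rotated]) (simp add: r)
    then have low: "2 ^ Suc s dvd c (2 ^ r) k"
      by (simp only: dvd_iff_of_dvd_diff dvd_triv_left)
    have odd_iff: "odd (?f i) \<longleftrightarrow> l = 0 \<or> l = 2 ^ s"
      unfolding odd_square_poly_coeff_iff l by (metis of_nat_0 of_nat_eq_iff of_nat_numeral of_nat_power)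
    show ?thesis
      using v2_ge[of r "c (2 ^ r) k"] v2_eq[OF low] iff odd_iff r by blast
  qed
  have even_case: "v2 (c (2 ^ r) k) = ereal (real s) - v2 l"
    if kl: "2 ^ r - k = 2 * l" "1 \<le> l" "l \<le> 2 ^ s"
  proof -
    obtain i where l: "l = int i"
      using kl(2) by (metis nonneg_int_cases order_trans zero_le_one)
    have k: "k = int (2 * ?n) - int (2 * i)"
      using kl(1) by (simp add: r l)
    have "2 * int ?n dvd c (2 ^ r) k - ?f i"
      using c_even_cong[of ?n i] by (simp add: k r)
    then have "2 ^ Suc s dvd c (2 ^ r) k - ?f i"
      by (rule dvd_trans[rotated]) simp
    moreover have "0 < i" "i \<le> 2 ^ s"
      using kl(2,3) by (simp_all add: l)
    ultimately show ?thesis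
      unfolding l by (intro v2_square_poly_coeff_cong)
  qed
  show ?thesis
    using odd_case even_case by (simp add: r)
qed

end
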